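(* Let $R_n$ be the $n\times n$ Redheffer matrix, i.e. the matrix whose $(i,j)$ entry ($1\le i,j\le n$) is $1$ if $i$ divides $j$ or if $j=1$, and is $0$ otherwise. The permanent of $R_n$ is $$1+\sum_{k=1}^n f(k),$$ where $f(k)$ is the number of ordered factorizations of the integer $k$ (with $f(1)=0$). The permutations of $\{1,\dots,n\}$ that contribute to this permanent are those in which there is just one cycle of length $>1$, the letter $1$ lives in that cycle, and the elements of that cycle form a division chain.
   Context: The permanent of an $n\times n$ matrix $A=(A_{i,j})$ is $\sum_{\sigma}\prod_{i=1}^n A_{i,\sigma(i)}$, the sum being over all permutations $\sigma$ of $\{1,\dots,n\}$. A permutation $\sigma$ contributes to the permanent of $R_n$ if it does not hit any $0$ entry of the matrix, i.e. $(R_n)_{i,\sigma(i)}\ne 0$ for all $i$. An ordered factorization of an integer $m$ is a representation $m=a_1a_2\cdots a_k$ in which all $a_i$ are integers $\ge 2$ and the order of the factors is important. The empty factorization is not counted in $f$, so $f(1)=0$; it is accounted for by the separate term $1$. The elements of a cycle $1\mapsto j_2\mapsto j_3\mapsto\cdots\mapsto j_k\mapsto 1$ form a division chain if the sequence $j_2,j_3,\dots,j_k$ is a chain under divisibility, i.e. $j_2$ divides $j_3$, $j_3$ divides $j_4$, and so on up to $j_k$.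
   Formalization: The identity permutation also contributes to the permanent (it is the separate term 1) though it has no cycle of length >1; the characterization proved lists the identity as an additional contributing permutation. *)

theory Defs
  imports "HOL-Combinatorics.Cycles" "HOL-Combinatorics.Orbits"
begin

text \<open>
  An \<open>n \<times> n\<close> matrix is a function \<open>nat \<Rightarrow> nat \<Rightarrow> 'a\<close>; rows and columns are indexed from \<open>1\<close>
  to \<open>n\<close>, and only the entries with both indices in \<open>{1..n}\<close> are ever used.
\<close>

definition permanent :: "nat \<Rightarrow> (nat \<Rightarrow> nat \<Rightarrow> 'a::comm_semiring_1) \<Rightarrow> 'a" where
  "permanent n A = (\<Sum>\<sigma> | \<sigma> permutes {1..n}. \<Prod>i = 1..n. A i (\<sigma> i))"

definition contributes :: "nat \<Rightarrow> (nat \<Rightarrow> nat \<Rightarrow> 'a::comm_semiring_1) \<Rightarrow> (nat \<Rightarrow> nat) \<Rightarrow> bool" where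
  "contributes n A \<sigma> \<longleftrightarrow> \<sigma> permutes {1..n} \<and> (\<forall>i\<in>{1..n}. A i (\<sigma> i) \<noteq> 0)"

text \<open>The entries do not depend on \<open>n\<close>: \<open>R\<^sub>n\<close> is the leading \<open>n \<times> n\<close> block.\<close>

definition redheffer :: "nat \<Rightarrow> nat \<Rightarrow> int" where
  "redheffer i j = (if i dvd j \<or> j = 1 then 1 else 0)"

definition ordered_factorizations :: "nat \<Rightarrow> nat list set" where
  "ordered_factorizations m = {as. as \<noteq> [] \<and> (\<forall>a\<in>set as. 2 \<le> a) \<and> prod_list as = m}"

definition num_ordered_factorizations :: "nat \<Rightarrow> nat" where
  "num_ordered_factorizations m = card (ordered_factorizations m)"

text \<open>The sets of letters of the cycles of \<open>\<sigma>\<close> on \<open>S\<close>, fixed points included as singletons.\<close>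

definition cycles_on :: "'a set \<Rightarrow> ('a \<Rightarrow> 'a) \<Rightarrow> 'a set set" where
  "cycles_on S \<sigma> = orbit \<sigma> ` S"

text \<open>
  For a permutation with cycle \<open>1 \<mapsto> j\<^sub>2 \<mapsto> \<dots> \<mapsto> j\<^sub>k \<mapsto> 1\<close>, the list \<open>support \<sigma> 1\<close> is
  \<open>[1, j\<^sub>2, \<dots>, j\<^sub>k]\<close>.
\<close>

definition cycle_of_1_is_division_chain :: "(nat \<Rightarrow> nat) \<Rightarrow> bool" where
  "cycle_of_1_is_division_chain \<sigma> \<longleftrightarrow> successively (dvd) (tl (support \<sigma> 1))"

text \<open>\<open>num_ordered_factorizations\<close> counts finite sets, and \<open>1\<close> has no factorization.\<close>

lemma length_le_prod_list:
  assumes "\<forall>a\<in>set as. (2::nat) \<le> a"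
  shows "length as < prod_list as"
  using assms
proof (induction as)
  case (Cons a as)
  then have IH: "length as < prod_list as" and "2 * prod_list as \<le> a * prod_list as"
    by simp_all
  then have "Suc (length as) < a * prod_list as" by linarith
  then show ?case by simp
qed simp

lemma finite_ordered_factorizations: "finite (ordered_factorizations m)"
proof (rule finite_subset)
  show "ordered_factorizations m \<subseteq> {as. set as \<subseteq> {..m} \<and> length as \<le> m}"
  proof
    fix as assume "as \<in> ordered_factorizations m"
    then have as: "\<forall>a\<in>set as. 2 \<le> a" "prod_list as = m"
      by (auto simp: ordered_factorizations_def)
    have less: "length as < m"
      using length_le_prod_list[OF as(1)] as(2) by simp
    have "a \<le> m" if "a \<in> set as" for a
    proof -
      have "a dvd m" using that as(2) by (metis dvd_triv_left mult.left_commute prod_list.Cons prod_list.append split_list)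
      with less show ?thesis by (intro dvd_imp_le) auto
    qed
    with less show "as \<in> {as. set as \<subseteq> {..m} \<and> length as \<le> m}" by auto
  qed
qed (rule finite_lists_length_le, simp)

lemma num_ordered_factorizations_1: "num_ordered_factorizations 1 = 0"
proof -
  have "ordered_factorizations 1 = {}"
    using length_le_prod_list by (fastforce simp: ordered_factorizations_def)
  then show ?thesis by (simp add: num_ordered_factorizations_def)
qed

end

theory Submission
  imports Defs
begin

text \<open>
  Along a contributing permutation, a letter that is not sent to \<open>1\<close> is sent to one of its
  multiples, so a cycle avoiding \<open>1\<close> would be weakly increasing and is therefore a fixed point.
  For the count, let \<open>1 \<mapsto> \<dots> \<mapsto> d \<mapsto> m \<mapsto> 1\<close> be the cycle of \<open>1\<close>. Composing with the
  transposition of \<open>d\<close> and \<open>m\<close> removes \<open>m\<close> from the cycle, and correspondingly the last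
  factor \<open>m / d\<close> from an ordered factorization of \<open>m\<close>. Iterating gives a bijection between
  contributing permutations and lists of factors \<open>\<ge> 2\<close> with product at most \<open>n\<close>; the identity
  corresponds to the empty list.
\<close>

section \<open>The permanent as a count of contributing permutations\<close>

lemma contributes_redheffer_iff:
  "contributes n redheffer \<sigma> \<longleftrightarrow>
     \<sigma> permutes {1..n} \<and> (\<forall>i\<in>{1..n}. i dvd \<sigma> i \<or> \<sigma> i = 1)"
  unfolding contributes_def redheffer_def by (simp del: One_nat_def)

text \<open>All entries are 0 or 1, so each permutation's product is 1 if it contributes and 0
  otherwise.\<close>

lemma permanent_redheffer_eq_card:
  "permanent n redheffer = int (card {\<sigma>. contributes n redheffer \<sigma>})"
proof -
  let ?P = "{\<sigma>. \<sigma> permutes {1..n}}"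
  have fin: "finite ?P" by (simp add: finite_permutations)
  have "(\<Prod>i = 1..n. redheffer i (\<sigma> i)) = (if contributes n redheffer \<sigma> then 1 else 0)"
    if "\<sigma> permutes {1..n}" for \<sigma>
  proof (cases "contributes n redheffer \<sigma>")
    case True
    then have "(\<Prod>i = 1..n. redheffer i (\<sigma> i)) = (\<Prod>i = 1..n. 1)"
      unfolding contributes_redheffer_iff by (intro prod.cong refl) (simp add: redheffer_def)
    with True show ?thesis by simp
  next
    case False
    with that have "\<exists>i\<in>{1..n}. redheffer i (\<sigma> i) = 0" by (auto simp: contributes_def)
    with False show ?thesis by (simp add: prod_zero)
  qed
  then have "permanent n redheffer = (\<Sum>\<sigma>\<in>?P. if contributes n redheffer \<sigma> then 1 else 0)"
    unfolding permanent_def by (intro sum.cong) auto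
  also have "\<dots> = int (card (?P \<inter> {\<sigma>. contributes n redheffer \<sigma>}))"
    using fin by (simp add: sum.If_cases)
  also have "?P \<inter> {\<sigma>. contributes n redheffer \<sigma>} = {\<sigma>. contributes n redheffer \<sigma>}"
    by (auto simp: contributes_def)
  finally show ?thesis .
qed


section \<open>The cycles of a contributing permutation\<close>

lemma contributes_redheffer_le:
  assumes "contributes n redheffer \<sigma>" "i \<in> {1..n}" "\<sigma> i \<noteq> 1"
  shows "i \<le> \<sigma> i"
proof -
  \<comment> \<open>Everything divides 0, so a bound from divisibility requires the image to be
    positive.\<close>
  have "\<sigma> i \<in> {1..n}"
    using assms permutes_in_image[of \<sigma> "{1..n}" i] by (auto simp: contributes_def)
  moreover have "i dvd \<sigma> i" using assms unfolding contributes_redheffer_iff by blast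
  ultimately show ?thesis by (intro dvd_imp_le) auto
qed

text \<open>Along an orbit missing 1 the values never decrease, so \<open>\<sigma> i\<close> is the
  least letter of its orbit. That orbit returns to \<open>i\<close>, hence
  \<open>\<sigma> i \<le> i\<close>; together with \<open>i \<le> \<sigma> i\<close> this makes
  \<open>i\<close> a fixed point.\<close>

lemma one_in_orbit_if_moved:
  assumes con: "contributes n redheffer \<sigma>" and moved: "\<sigma> i \<noteq> i"
  shows "1 \<in> orbit \<sigma> i"
proof (rule ccontr)
  assume no1: "1 \<notin> orbit \<sigma> i"
  have perm: "\<sigma> permutes {1..n}" using con by (simp add: contributes_def)
  then have permn: "permutation \<sigma>" by (auto simp: permutation_permutes)
  have i: "i \<in> {1..n}" using moved perm by (metis permutes_not_in)
  have "i \<in> orbit \<sigma> (\<sigma> i)"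
    using permn by (simp add: permutation_orbit_step permutation_self_in_orbit)
  moreover have "\<sigma> i \<le> j" if "j \<in> orbit \<sigma> (\<sigma> i)" for j
  proof -
    have le_image: "j \<le> \<sigma> j" if "j \<in> orbit \<sigma> i" for j
    proof (rule contributes_redheffer_le[OF con])
      show "j \<in> {1..n}" using that permutes_orbit_subset[OF perm i] by blast
      show "\<sigma> j \<noteq> 1" using no1 orbit.step[OF that] by auto
    qed
    from that show ?thesis
    proof induction
      case base
      show ?case by (intro le_image orbit.base)
    next
      case (step j)
      then show ?case using le_image[of j] by (auto dest: orbit_subset)
    qed
  qed
  ultimately have "\<sigma> i \<le> i" by blast
  moreover have "i \<le> \<sigma> i"
    using no1 i orbit.base[of \<sigma> i] by (intro contributes_redheffer_le[OF con]) auto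
  ultimately show False using moved by simp
qed

lemma card_orbit_gt_one_iff:
  assumes "permutation \<sigma>"
  shows "card (orbit \<sigma> i) > 1 \<longleftrightarrow> \<sigma> i \<noteq> i"
proof -
  have self: "i \<in> orbit \<sigma> i" using assms by (rule permutation_self_in_orbit)
  then have "card (orbit \<sigma> i) \<noteq> 0" by (auto simp: finite_orbit)
  moreover have "\<sigma> i = i \<longleftrightarrow> card (orbit \<sigma> i) = 1"
    using cyclic_on_orbit'[OF assms] self by (rule eq_on_cyclic_on_iff1)
  ultimately show ?thesis by linarith
qed

text \<open>Apart from the final return to \<open>1\<close>, consecutive entries of the support of \<open>1\<close> are
  consecutive images, so its tail being a chain is the divisibility condition on that cycle.\<close>

lemma cycle_of_1_is_division_chain_iff:
  assumes permn: "permutation \<sigma>"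
  shows "cycle_of_1_is_division_chain \<sigma> \<longleftrightarrow> (\<forall>i\<in>orbit \<sigma> 1. i dvd \<sigma> i \<or> \<sigma> i = 1)"
    (is "_ \<longleftrightarrow> ?R")
proof -
  define l where "l = least_power \<sigma> 1"
  have l: "(\<sigma> ^^ l) 1 = 1" "l > 0"
    using least_power_of_permutation[OF permn, of 1] by (auto simp: l_def)
  have ne1: "(\<sigma> ^^ k) 1 \<noteq> 1" if "0 < k" "k < l" for k
    using that least_power_le[of k \<sigma> 1] by (auto simp: l_def)
  have "tl (support \<sigma> 1) = map (\<lambda>k. (\<sigma> ^^ k) 1) [1..<l]"
    by (simp add: l_def map_tl[symmetric])
  then have "cycle_of_1_is_division_chain \<sigma> \<longleftrightarrow>
      (\<forall>k. Suc (Suc k) < l \<longrightarrow> (\<sigma> ^^ Suc k) 1 dvd (\<sigma> ^^ Suc (Suc k)) 1)"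
    unfolding cycle_of_1_is_division_chain_def
    by (simp add: successively_conv_nth less_diff_conv del: funpow.simps)
  also have "\<dots> \<longleftrightarrow> (\<forall>k<l. (\<sigma> ^^ k) 1 dvd \<sigma> ((\<sigma> ^^ k) 1) \<or> \<sigma> ((\<sigma> ^^ k) 1) = 1)"
  proof (intro iffI allI impI)
    fix k
    assume *: "\<forall>k. Suc (Suc k) < l \<longrightarrow> (\<sigma> ^^ Suc k) 1 dvd (\<sigma> ^^ Suc (Suc k)) 1"
      and "k < l"
    \<comment> \<open>The letter 1 divides everything, inner letters are covered by the chain, and
      the last letter returns to 1.\<close>
    then consider "k = 0" | j where "k = Suc j" "Suc (Suc j) < l" | "Suc k = l"
      by (cases k) (simp, metis Suc_lessI)
    then show "(\<sigma> ^^ k) 1 dvd \<sigma> ((\<sigma> ^^ k) 1) \<or> \<sigma> ((\<sigma> ^^ k) 1) = 1"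
      using * l(1) by cases auto
  next
    fix k
    assume *: "\<forall>k<l. (\<sigma> ^^ k) 1 dvd \<sigma> ((\<sigma> ^^ k) 1) \<or> \<sigma> ((\<sigma> ^^ k) 1) = 1"
      and k: "Suc (Suc k) < l"
    \<comment> \<open>Before step \<open>l\<close> the cycle has not returned to 1, which excludes
      the second alternative.\<close>
    then show "(\<sigma> ^^ Suc k) 1 dvd (\<sigma> ^^ Suc (Suc k)) 1"
      using *[rule_format, of "Suc k"] ne1[of "Suc (Suc k)"] by simp
  qed
  also have "\<dots> \<longleftrightarrow> ?R"
    unfolding orbit_altdef_bounded[OF l] by blast
  finally show ?thesis .
qed

text \<open>Every moved letter shares the orbit of 1, so there is at most one nontrivial cycle; the
  identity has none and forms its own case. Conversely, fixed letters divide themselves and moved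
  ones lie in the orbit of 1, where the chain gives divisibility.\<close>

lemma contributes_redheffer_iff_division_chain:
  "contributes n redheffer \<sigma> \<longleftrightarrow>
     \<sigma> permutes {1..n} \<and>
     (\<sigma> = id \<or>
      (\<exists>C. {D \<in> cycles_on {1..n} \<sigma>. card D > 1} = {C} \<and> 1 \<in> C \<and>
           cycle_of_1_is_division_chain \<sigma>))"
proof (cases "\<sigma> permutes {1..n}")
  case perm: True
  then have permn: "permutation \<sigma>" by (auto simp: permutation_permutes)
  have orbit_eq: "orbit \<sigma> i = orbit \<sigma> j" if "i \<in> orbit \<sigma> j" for i j
    using cyclic_on_orbit'[OF permn] that by (rule orbit_cyclic_eq3)
  have cycles: "{D \<in> cycles_on {1..n} \<sigma>. card D > 1} = {orbit \<sigma> i |i. \<sigma> i \<noteq> i}"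
  proof -
    have "i \<in> {1..n}" if "\<sigma> i \<noteq> i" for i using perm that by (metis permutes_not_in)
    then show ?thesis
      unfolding cycles_on_def using card_orbit_gt_one_iff[OF permn] by blast
  qed
  show ?thesis
  proof
    assume con: "contributes n redheffer \<sigma>"
    show "\<sigma> permutes {1..n} \<and> (\<sigma> = id \<or>
      (\<exists>C. {D \<in> cycles_on {1..n} \<sigma>. card D > 1} = {C} \<and> 1 \<in> C \<and>
           cycle_of_1_is_division_chain \<sigma>))"
    proof (cases "\<sigma> = id")
      case False
      then obtain i where i: "\<sigma> i \<noteq> i" by (auto simp: fun_eq_iff)
      have eq: "orbit \<sigma> j = orbit \<sigma> 1" if "\<sigma> j \<noteq> j" for j
        using orbit_eq[OF one_in_orbit_if_moved[OF con that]] by simp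
      with i have "{D \<in> cycles_on {1..n} \<sigma>. card D > 1} = {orbit \<sigma> 1}"
        unfolding cycles by blast
      \<comment> \<open>A moved letter forces \<open>n\<close> to be positive, so 1 and its whole
        orbit lie in \<open>{1..n}\<close>.\<close>
      moreover have "i \<in> {1..n}" using i perm by (metis permutes_not_in)
      then have "orbit \<sigma> 1 \<subseteq> {1..n}" by (intro permutes_orbit_subset[OF perm]) auto
      then have "cycle_of_1_is_division_chain \<sigma>"
        using con by (auto simp: cycle_of_1_is_division_chain_iff[OF permn]
          contributes_redheffer_iff)
      ultimately show ?thesis
        using perm permutation_self_in_orbit[OF permn] by blast
    qed (use perm in simp)
  next
    assume "\<sigma> permutes {1..n} \<and> (\<sigma> = id \<or>
      (\<exists>C. {D \<in> cycles_on {1..n} \<sigma>. card D > 1} = {C} \<and> 1 \<in> C \<and>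
           cycle_of_1_is_division_chain \<sigma>))"
    then consider "\<sigma> = id"
      | C where "{orbit \<sigma> i |i. \<sigma> i \<noteq> i} = {C}" "1 \<in> C" "cycle_of_1_is_division_chain \<sigma>"
      unfolding cycles by blast
    then show "contributes n redheffer \<sigma>"
    proof cases
      case 1
      then show ?thesis by (simp add: contributes_redheffer_iff)
    next
      case 2
      have "i dvd \<sigma> i \<or> \<sigma> i = 1" for i
      proof (cases "\<sigma> i = i")
        case False
        with 2 have "1 \<in> orbit \<sigma> i" by auto
        then have "i \<in> orbit \<sigma> 1"
          using orbit_eq permutation_self_in_orbit[OF permn] by metis
        with 2 show ?thesis by (simp add: cycle_of_1_is_division_chain_iff[OF permn])
      qed simp
      with perm show ?thesis by (simp add: contributes_redheffer_iff)
    qed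
  qed
qed (simp add: contributes_def)


section \<open>Contributing permutations and ordered factorizations\<close>

text \<open>The factors are listed last one first: \<open>[a\<^sub>k, \<dots>, a\<^sub>1]\<close> is sent to the cycle
  \<open>1 \<mapsto> a\<^sub>1 \<mapsto> a\<^sub>1a\<^sub>2 \<mapsto> \<dots> \<mapsto> a\<^sub>1\<cdots>a\<^sub>k \<mapsto> 1\<close>.\<close>

fun perm_of_factors :: "nat list \<Rightarrow> nat \<Rightarrow> nat" where
  "perm_of_factors [] = id"
| "perm_of_factors (a # as) =
     perm_of_factors as \<circ> transpose (prod_list as) (a * prod_list as)"

lemma prod_list_pos_if_ge_two: "\<forall>a\<in>set as. (2::nat) \<le> a \<Longrightarrow> 0 < prod_list as"
  using length_le_prod_list[of as] by simp

lemma perm_of_factors_permutes: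
  assumes "\<forall>a\<in>set as. 2 \<le> a"
  shows "perm_of_factors as permutes {1..prod_list as}"
  using assms
proof (induction as)
  case (Cons a as)
  let ?m = "prod_list as"
  have m: "0 < ?m" "?m \<le> a * ?m"
    using Cons.prems prod_list_pos_if_ge_two[of as] by auto
  have "perm_of_factors as permutes {1..?m}" using Cons by simp
  then have "perm_of_factors as permutes {1..a * ?m}"
    by (rule permutes_subset) (use m in auto)
  moreover have "transpose ?m (a * ?m) permutes {1..a * ?m}"
    using m by (intro permutes_swap_id) auto
  ultimately have "perm_of_factors as \<circ> transpose ?m (a * ?m) permutes {1..a * ?m}"
    by (rule permutes_compose[rotated])
  then show ?case by (simp only: perm_of_factors.simps prod_list.Cons)
qed (simp add: permutes_id)

lemma perm_of_factors_fixes: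
  assumes "\<forall>a\<in>set as. 2 \<le> a" "prod_list as < i"
  shows "perm_of_factors as i = i"
  using permutes_not_in[OF perm_of_factors_permutes[OF assms(1)]] assms(2) by simp

text \<open>Each transposition sends the new last letter to the previous one, which returns to 1 by
  induction.\<close>

lemma perm_of_factors_prod_list:
  assumes "\<forall>a\<in>set as. 2 \<le> a"
  shows "perm_of_factors as (prod_list as) = 1"
  using assms by (induction as) simp_all

text \<open>The transposition yields a letter larger than \<open>prod_list as\<close>, which
  \<open>perm_of_factors as\<close> fixes.\<close>

lemma perm_of_factors_Cons_prod_list:
  assumes "\<forall>b\<in>set (a # as). 2 \<le> b"
  shows "perm_of_factors (a # as) (prod_list as) = a * prod_list as"
  using assms prod_list_pos_if_ge_two[of as] by (simp add: perm_of_factors_fixes)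

lemma contributes_perm_of_factors:
  assumes "\<forall>a\<in>set as. 2 \<le> a" "prod_list as \<le> n"
  shows "contributes n redheffer (perm_of_factors as)"
proof -
  have "perm_of_factors as permutes {1..n}"
    using assms by (intro permutes_subset[OF perm_of_factors_permutes]) auto
  moreover have "i dvd perm_of_factors as i \<or> perm_of_factors as i = 1" for i
    using assms(1)
  proof (induction as arbitrary: i)
    case (Cons a as)
    \<comment> \<open>The old last letter goes to a multiple, the new one goes to 1, and all others
      are unaffected by the transposition.\<close>
    consider "i = prod_list as" | "i = prod_list (a # as)"
      | "i \<noteq> prod_list as" "i \<noteq> prod_list (a # as)" by blast
    then show ?case
    proof cases
      case 1
      with Cons.prems show ?thesis
        by (simp only: perm_of_factors_Cons_prod_list) simp
    next
      case 2
      then show ?thesis using perm_of_factors_prod_list[OF Cons.prems] by simp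
    next
      case 3
      then show ?thesis using Cons by simp
    qed
  qed simp
  ultimately show ?thesis by (simp add: contributes_redheffer_iff)
qed

text \<open>The permutation determines the product as the preimage of 1, and the product without the
  head as the preimage of that letter. The quotient is the head factor; cancelling the transposition
  reduces to the tails.\<close>

lemma inj_on_perm_of_factors: "inj_on perm_of_factors {as. \<forall>a\<in>set as. 2 \<le> a}"
proof (rule inj_onI, unfold mem_Collect_eq)
  have prod_eq: "prod_list as = prod_list bs"
    if "\<forall>a\<in>set as. 2 \<le> a" "\<forall>b\<in>set bs. 2 \<le> b" "perm_of_factors as = perm_of_factors bs"
    for as bs
  proof -
    have "inj (perm_of_factors as)"
      using perm_of_factors_permutes[OF that(1)] by (rule permutes_inj)
    then show ?thesis
      using that perm_of_factors_prod_list[of as] perm_of_factors_prod_list[of bs]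
      by (metis injD)
  qed
  fix as bs
  assume "\<forall>a\<in>set as. 2 \<le> a" "\<forall>b\<in>set bs. 2 \<le> b" "perm_of_factors as = perm_of_factors bs"
  then show "as = bs"
  proof (induction as arbitrary: bs)
    case Nil
    then have "prod_list bs = 1" using prod_eq[of "[]" bs] by (metis prod_list.Nil)
    then show ?case using length_le_prod_list[of bs] Nil.prems by simp
  next
    case (Cons a as)
    have prod: "prod_list (a # as) = prod_list bs"
      using Cons.prems by (rule prod_eq)
    moreover have "1 < prod_list (a # as)"
      using length_le_prod_list[OF Cons.prems(1)] by simp
    ultimately obtain b cs where bs: "bs = b # cs" by (cases bs) auto
    have "inj (perm_of_factors (a # as))"
      using perm_of_factors_permutes[OF Cons.prems(1)] by (rule permutes_inj)
    moreover have "perm_of_factors (a # as) (prod_list as) =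
        perm_of_factors (a # as) (prod_list cs)"
    proof -
      have "perm_of_factors (a # as) (prod_list as) = prod_list (a # as)"
        using perm_of_factors_Cons_prod_list[OF Cons.prems(1)] by simp
      also have "\<dots> = perm_of_factors bs (prod_list cs)"
        using perm_of_factors_Cons_prod_list[OF Cons.prems(2)[unfolded bs]] prod bs by simp
      finally show ?thesis using Cons.prems(3) by metis
    qed
    ultimately have prod': "prod_list as = prod_list cs" by (rule injD)
    moreover have "prod_list as \<noteq> 0"
      using prod_list_pos_if_ge_two[of as] Cons.prems(1) by simp
    ultimately have ab: "a = b" using prod bs by simp
    let ?t = "transpose (prod_list as) (a * prod_list as)"
    have "perm_of_factors as \<circ> ?t = perm_of_factors cs \<circ> ?t"
      using Cons.prems(3) by (simp only: bs ab prod' perm_of_factors.simps)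
    then have "perm_of_factors as \<circ> ?t \<circ> ?t = perm_of_factors cs \<circ> ?t \<circ> ?t" by (rule arg_cong)
    then have "perm_of_factors as = perm_of_factors cs" by (simp add: comp_assoc)
    then have "as = cs"
      using Cons.prems bs by (intro Cons.IH) auto
    with ab bs show ?case by simp
  qed
qed

text \<open>A moved letter would share the orbit of 1, which here is a singleton.\<close>

lemma contributes_redheffer_fixing_one:
  assumes con: "contributes n redheffer \<sigma>" and fix1: "\<sigma> 1 = 1"
  shows "\<sigma> = id"
proof (rule ccontr)
  assume "\<sigma> \<noteq> id"
  then obtain i where i: "\<sigma> i \<noteq> i" by (auto simp: fun_eq_iff)
  have permn: "permutation \<sigma>"
    using con by (auto simp: contributes_def permutation_permutes)
  have "orbit \<sigma> 1 = orbit \<sigma> i"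
    using orbit_cyclic_eq3[OF cyclic_on_orbit'[OF permn] one_in_orbit_if_moved[OF con i]] .
  moreover have "orbit \<sigma> 1 = {1}" using fix1 by (simp add: orbit_eq_singleton_iff)
  ultimately show False using i fix1 permutation_self_in_orbit[OF permn, of i] by auto
qed

text \<open>Strong induction on the last letter \<open>m\<close> of the cycle of 1: removing
  \<open>m\<close> leaves a contributing permutation whose last letter is the predecessor
  \<open>d\<close>, a proper divisor of \<open>m\<close>. Keeping \<open>n\<close> fixed lets the
  shortened permutation remain in the same setting.\<close>

lemma contributes_redheffer_obtain_factors:
  assumes "contributes n redheffer \<sigma>" "\<sigma> m = 1" "m \<in> {1..n}"
  shows "\<exists>as. (\<forall>a\<in>set as. 2 \<le> a) \<and> prod_list as = m \<and> \<sigma> = perm_of_factors as"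
  using assms
proof (induction m arbitrary: \<sigma> rule: less_induct)
  case (less m)
  show ?case
  proof (cases "m = 1")
    case True
    with less.prems have "\<sigma> = id" by (intro contributes_redheffer_fixing_one) simp_all
    with True show ?thesis by (intro exI[of _ "[]"]) simp
  next
    case False
    have perm: "\<sigma> permutes {1..n}" using less.prems by (simp add: contributes_def)
    obtain d where d: "\<sigma> d = m" using permutes_surj[OF perm] by (metis surjD)
    have d_in: "d \<in> {1..n}"
      using d less.prems(3) permutes_in_image[OF perm, of d] by simp
    have "d dvd m"
      using less.prems(1) d d_in False by (auto simp: contributes_redheffer_iff)
    then obtain a where a: "m = a * d" by (metis dvd_def mult.commute)
    have "d \<noteq> m" using d less.prems(2) False by auto
    with a less.prems(3) have "2 \<le> a" by (cases "a = 0 \<or> a = 1") auto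
    with a d_in have "d < m" by simp
    define \<tau> where "\<tau> = \<sigma> \<circ> transpose d m"
    have "\<tau> permutes {1..n}"
      unfolding \<tau>_def using perm less.prems(3) d_in by (intro permutes_compose permutes_swap_id)
    \<comment> \<open>Now \<open>d\<close> goes to 1, \<open>m\<close> is fixed, and all other
      images are unchanged.\<close>
    moreover have "i dvd \<tau> i \<or> \<tau> i = 1" if "i \<in> {1..n}" for i
      using that less.prems d
      by (cases "i = d"; cases "i = m") (auto simp: \<tau>_def contributes_redheffer_iff)
    ultimately have "contributes n redheffer \<tau>" by (simp add: contributes_redheffer_iff)
    moreover have "\<tau> d = 1" using less.prems by (simp add: \<tau>_def)
    ultimately obtain as where as: "\<forall>a\<in>set as. 2 \<le> a" "prod_list as = d" "\<tau> = perm_of_factors as"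
      using less.IH[of d \<tau>] \<open>d < m\<close> d_in by blast
    have "\<sigma> = \<tau> \<circ> transpose d m" by (simp add: \<tau>_def comp_assoc)
    with as a \<open>2 \<le> a\<close> show ?thesis by (intro exI[of _ "a # as"]) auto
  qed
qed

section \<open>The bijection and the resulting count\<close>

text \<open>Positivity of \<open>n\<close> places 1, hence also its preimage, in
  \<open>{1..n}\<close>. For \<open>n = 0\<close> the identity still contributes, while the empty
  list has product 1 and is excluded.\<close>

lemma bij_betw_perm_of_factors:
  assumes "0 < n"
  shows "bij_betw perm_of_factors {as. (\<forall>a\<in>set as. 2 \<le> a) \<and> prod_list as \<le> n}
           {\<sigma>. contributes n redheffer \<sigma>}"
  unfolding bij_betw_def
proof (intro conjI set_eqI iffI)
  show "inj_on perm_of_factors {as. (\<forall>a\<in>set as. 2 \<le> a) \<and> prod_list as \<le> n}"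
    by (rule inj_on_subset[OF inj_on_perm_of_factors]) auto
  fix \<sigma> assume "\<sigma> \<in> {\<sigma>. contributes n redheffer \<sigma>}"
  then have con: "contributes n redheffer \<sigma>" by simp
  then have perm: "\<sigma> permutes {1..n}" by (simp add: contributes_def)
  obtain m where m: "\<sigma> m = 1" using permutes_surj[OF perm] by (metis surjD)
  moreover have "m \<in> {1..n}" using m assms permutes_in_image[OF perm, of m] by simp
  ultimately show "\<sigma> \<in> perm_of_factors ` {as. (\<forall>a\<in>set as. 2 \<le> a) \<and> prod_list as \<le> n}"
    using contributes_redheffer_obtain_factors[OF con] by fastforce
qed (auto intro: contributes_perm_of_factors)

text \<open>Nonempty lists are sorted by their product; the empty list supplies the extra 1.\<close>

lemma card_lists_prod_list_le:
  assumes "0 < n"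
  shows "card {as. (\<forall>a\<in>set as. 2 \<le> a) \<and> prod_list as \<le> n} =
    1 + (\<Sum>k = 1..n. num_ordered_factorizations k)"
proof -
  have "{as. (\<forall>a\<in>set as. 2 \<le> a) \<and> prod_list as \<le> n} =
      insert [] (\<Union>k\<in>{1..n}. ordered_factorizations k)"
    using assms prod_list_pos_if_ge_two
    by (fastforce simp: ordered_factorizations_def Suc_le_eq)
  also have "card \<dots> = 1 + card (\<Union>k\<in>{1..n}. ordered_factorizations k)"
    by (subst card_insert_disjoint)
      (auto simp: finite_ordered_factorizations, auto simp: ordered_factorizations_def)
  also have "card (\<Union>k\<in>{1..n}. ordered_factorizations k) =
      (\<Sum>k = 1..n. num_ordered_factorizations k)"
    unfolding num_ordered_factorizations_def
    by (intro card_UN_disjoint)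
      (auto simp: finite_ordered_factorizations, auto simp: ordered_factorizations_def)
  finally show ?thesis .
qed

lemma permanent_redheffer:
  "permanent n redheffer = 1 + (\<Sum>k = 1..n. int (num_ordered_factorizations k))"
proof (cases "n = 0")
  case True
  \<comment> \<open>The empty set has one permutation, with empty product 1, and the sum on the
    right is empty.\<close>
  then show ?thesis by (simp add: permanent_def)
next
  case False
  then show ?thesis
    by (simp add: permanent_redheffer_eq_card card_lists_prod_list_le
        bij_betw_same_card[OF bij_betw_perm_of_factors, symmetric])
qed

theorem theorem1:
  fixes n :: nat
  shows "permanent n redheffer = 1 + (\<Sum>k = 1..n. int (num_ordered_factorizations k)) \<and>
    (\<forall>\<sigma>. contributes n redheffer \<sigma> \<longleftrightarrow>
       \<sigma> permutes {1..n} \<and>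
       (\<sigma> = id \<or>
        (\<exists>C. {D \<in> cycles_on {1..n} \<sigma>. card D > 1} = {C} \<and> 1 \<in> C \<and>
             cycle_of_1_is_division_chain \<sigma>)))"
  by (intro conjI allI permanent_redheffer contributes_redheffer_iff_division_chain)

end
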